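(* Let $(\xi_k)_{k\ge 1}$ be an i.i.d. sequence of random variables with values in $[0,1]$ and continuous distribution function $F(t)=\mathsf{P}(\xi_1\le t)$, and let $F_n(t)=\frac1n\sum_{k=1}^n I_{\{\xi_k\le t\}}$ be the empirical distribution function. Then for every $\varepsilon>0$ and every $n\ge 1$, $$ \mathsf{P}\Big(\sup_{t\in[0,1]}|F_n(t)-F(t)|\ge \varepsilon\Big)\le 2\exp\Big(-n\Big[\frac{\varepsilon}{8}\Big\{\log\Big(1+\frac{\varepsilon^2}{32}\Big)-1\Big\}+\frac{4}{\varepsilon}\log\Big(1+\frac{\varepsilon^2}{32}\Big)\Big]\Big). $$
   Context: $I_{A}$ denotes the indicator of the event $A$, and $\log$ is the natural logarithm. *)

theory Defs
  imports "HOL-Probability.Probability"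
begin

definition empirical_cdf :: "(nat \<Rightarrow> 'a \<Rightarrow> real) \<Rightarrow> nat \<Rightarrow> 'a \<Rightarrow> real \<Rightarrow> real" where
  "empirical_cdf \<xi> n \<omega> t = (1 / real n) * (\<Sum>k = 1..n. indicat_real {..t} (\<xi> k \<omega>))"

end

theory Submission
  imports Defs
begin

text \<open>
  The exponent in the bound is small: \<open>ln (1 + x) \<le> x\<close> shows that it is at most
  \<open>n \<epsilon>\<^sup>3 / 256\<close>, which is far below the exponent of order \<open>n \<epsilon>\<^sup>2\<close> that Hoeffding's inequality
  gives at a single point. The proof therefore needs no sharp estimate of the supremum;
  discretising it is enough.

  Let \<open>m\<close> be a positive integer and pick, using continuity of \<open>F\<close>, quantiles \<open>s j\<close> with
  \<open>F (s j) = j / m\<close> for \<open>0 < j < m\<close>. Between neighbouring quantiles \<open>F\<close> grows by \<open>1 / m\<close>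
  only, and both \<open>F\<close> and the empirical distribution function are monotone, so a deviation of at
  most \<open>\<delta>\<close> at all quantiles forces a deviation of at most \<open>\<delta> + 1 / m\<close> everywhere
  (lemma \<open>mono_deviation_le_of_quantiles\<close>). Hoeffding's inequality at the \<open>m - 1\<close> quantiles and
  a union bound give probability at most \<open>2 (m - 1) exp (- 2 n \<delta>\<^sup>2)\<close> for a larger deviation
  (lemma \<open>prob_sup_deviation_le\<close>).

  With \<open>\<delta> = \<epsilon> / 2\<close> and \<open>m - 1 = \<lfloor>2 / \<epsilon>\<rfloor>\<close> this is at most \<open>2 (2 / \<epsilon>) exp (- n \<epsilon>\<^sup>2 / 2)\<close>.
  If \<open>n \<epsilon>\<^sup>3 < 128\<close>, then the claimed bound is at least \<open>2 exp (- 1 / 2) \<ge> 1\<close>, so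
  there is nothing to prove; otherwise \<open>n \<epsilon>\<^sup>2\<close> is at least \<open>128 / \<epsilon>\<close>, and for \<open>\<epsilon> \<le> 1\<close>
  the exponential absorbs the factor \<open>2 / \<epsilon>\<close>.
  For \<open>\<epsilon> > 1\<close> the same lemma with \<open>m = 1\<close> and \<open>\<delta> = 0\<close> gives probability \<open>0\<close>.
\<close>

section \<open>From quantiles to the supremum\<close>

text \<open>
  The point \<open>t\<close> is compared with the next quantile above it for the upper estimate and with the
  one below it for the lower estimate. Both are chosen by a strict inequality between values of
  \<open>F\<close>, since \<open>F\<close> may be constant on intervals and only a strict inequality
  orders the arguments. Near the ends no quantile is needed because \<open>G\<close> has values in \<open>[0, 1]\<close>.
\<close>

lemma mono_deviation_le_of_quantiles:
  fixes F G :: "real \<Rightarrow> real" and m :: nat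
  assumes F: "mono F" "\<And>t. F t \<in> {0..1}"
    and G: "mono G" "\<And>t. G t \<in> {0..1}"
    and m: "m \<ge> 1" and \<delta>: "\<delta> \<ge> 0"
    and s: "\<And>j. j \<in> {1..<m} \<Longrightarrow> F (s j) = real j / real m"
    and dev: "\<And>j. j \<in> {1..<m} \<Longrightarrow> \<bar>G (s j) - F (s j)\<bar> \<le> \<delta>"
  shows "\<bar>G t - F t\<bar> \<le> \<delta> + 1 / real m"
proof -
  have mpos: "real m > 0" using m by simp
  have Ft: "0 \<le> F t" "F t \<le> 1" and Gt: "0 \<le> G t" "G t \<le> 1"
    using F(2)[of t] G(2)[of t] by auto
  have upper: "G t - F t \<le> \<delta> + 1 / real m"
  proof -
    define j where "j = nat \<lfloor>real m * F t\<rfloor> + 1"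
    have "0 \<le> real m * F t" using Ft by simp
    hence j: "real m * F t < real j" "real j \<le> real m * F t + 1"
      unfolding j_def by linarith+
    have j': "F t < real j / real m" "real j / real m \<le> F t + 1 / real m"
      using j mpos by (auto simp: field_simps)
    show ?thesis
    proof (cases "j < m")
      case True
      hence jm: "j \<in> {1..<m}" by (simp add: j_def)
      have "t \<le> s j"
        using j'(1) s[OF jm] monoD[OF F(1), of "s j" t] by linarith
      hence "G t \<le> G (s j)" by (rule monoD[OF G(1)])
      thus ?thesis using dev[OF jm] s[OF jm] j'(2) by linarith
    next
      case False
      hence "1 \<le> real j / real m" using mpos by (simp add: field_simps)
      thus ?thesis using Gt \<delta> j'(2) by linarith
    qed
  qed
  have lower: "F t - G t \<le> \<delta> + 1 / real m"
  proof (cases "real m * F t \<le> 1")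
    case True
    hence "F t \<le> 1 / real m" using mpos by (simp add: field_simps)
    thus ?thesis using Gt \<delta> by linarith
  next
    case False
    define k where "k = nat (\<lceil>real m * F t\<rceil> - 1)"
    have k: "real k < real m * F t" "real m * F t \<le> real k + 1" "k \<ge> 1"
      using False unfolding k_def by linarith+
    have "real m * F t \<le> real m" using Ft mpos by (simp add: mult_left_le)
    with k have km: "k \<in> {1..<m}" by auto
    have k': "real k / real m < F t" "F t \<le> real k / real m + 1 / real m"
      using k mpos by (auto simp: field_simps)
    have "s k \<le> t"
      using k'(1) s[OF km] monoD[OF F(1), of t "s k"] by linarith
    hence "G (s k) \<le> G t" by (rule monoD[OF G(1)])
    thus ?thesis using dev[OF km] s[OF km] k'(2) by linarith
  qed
  from upper lower show ?thesis by (simp add: abs_le_iff)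
qed

lemma mono_empirical_cdf: "mono (empirical_cdf \<xi> n \<omega>)"
  unfolding empirical_cdf_def
  by (intro monoI mult_left_mono sum_mono) (auto simp: indicator_def)

lemma empirical_cdf_in_unit: "empirical_cdf \<xi> n \<omega> t \<in> {0..1}"
proof -
  have "(\<Sum>k = 1..n. indicat_real {..t} (\<xi> k \<omega>)) \<le> (\<Sum>k = 1..n. 1)"
    by (intro sum_mono) (simp add: indicator_def)
  thus ?thesis
    unfolding empirical_cdf_def by (auto simp: sum_nonneg divide_le_eq)
qed

section \<open>Probability of a large deviation\<close>

context prob_space
begin

lemma Hoeffding_empirical_cdf:
  assumes indep: "indep_vars (\<lambda>_. borel) \<xi> {1..}"
    and ident: "\<And>k. k \<ge> 1 \<Longrightarrow> distr M borel (\<xi> k) = distr M borel (\<xi> 1)"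
    and "n \<ge> 1" and "\<delta> \<ge> 0"
  shows "prob {\<omega> \<in> space M. \<bar>empirical_cdf \<xi> n \<omega> t - prob {\<omega> \<in> space M. \<xi> 1 \<omega> \<le> t}\<bar> \<ge> \<delta>}
    \<le> 2 * exp (- 2 * real n * \<delta>\<^sup>2)"
proof -
  have rv: "\<xi> k \<in> borel_measurable M" if "k \<ge> 1" for k
    using indep that unfolding indep_vars_def by auto
  have rv1[measurable]: "\<xi> 1 \<in> borel_measurable M" by (rule rv) simp
  define X where "X = (\<lambda>k \<omega>. indicat_real {..t} (\<xi> k \<omega>))"
  have ind: "indep_vars (\<lambda>_. borel) X {1..n}"
    unfolding X_def
    by (rule indep_vars_compose2[OF indep_vars_subset[OF indep]]) auto
  have dist: "distr M borel (X k) = distr M borel (X 1)" if "k \<in> {1..n}" for k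
  proof -
    have push: "distr M borel (X i) = distr (distr M borel (\<xi> i)) borel (indicat_real {..t})"
      if "i \<ge> 1" for i
      using rv[OF that] by (subst distr_distr) (auto simp: X_def o_def)
    show ?thesis using that ident[of k] push[of k] push[of 1] by simp
  qed
  have mean: "expectation (X 1) = prob {\<omega> \<in> space M. \<xi> 1 \<omega> \<le> t}"
  proof -
    have "expectation (X 1) = expectation (indicator {\<omega> \<in> space M. \<xi> 1 \<omega> \<le> t})"
      by (intro Bochner_Integration.integral_cong) (auto simp: X_def indicator_def)
    thus ?thesis by (simp add: Int_absorb2 Collect_restrict)
  qed
  interpret H: Hoeffding_ineq_iid M "{1..n}" X "X 1" 0 1 "expectation (X 1)"
  proof unfold_locales
    show "random_variable borel (X 1)" unfolding X_def by measurable
    show "AE x in M. X 1 x \<in> {0..1}" by (auto simp: X_def indicator_def)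
  qed (rule finite_atLeastAtMost ind dist reflexive | assumption)+
  have "{1..n} \<noteq> {}" using \<open>n \<ge> 1\<close> by auto
  from H.Hoeffding_ineq_abs_ge'[OF \<open>\<delta> \<ge> 0\<close> _ this]
  show ?thesis unfolding mean by (simp add: X_def empirical_cdf_def)
qed

lemma prob_sup_deviation_le:
  fixes \<xi> :: "nat \<Rightarrow> 'a \<Rightarrow> real" and m :: nat
  assumes indep: "indep_vars (\<lambda>_. borel) \<xi> {1..}"
    and ident: "\<And>k. k \<ge> 1 \<Longrightarrow> distr M borel (\<xi> k) = distr M borel (\<xi> 1)"
    and range: "\<And>\<omega>. \<omega> \<in> space M \<Longrightarrow> \<xi> 1 \<omega> \<in> {a..b}"
    and F: "\<And>t. F t = prob {\<omega> \<in> space M. \<xi> 1 \<omega> \<le> t}"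
    and cont: "continuous_on UNIV F"
    and T: "T \<noteq> {}" and n: "n \<ge> 1" and m: "m \<ge> 1" and \<delta>: "\<delta> \<ge> 0" "\<delta> + 1 / real m < \<epsilon>"
  shows "prob {\<omega> \<in> space M. (SUP t\<in>T. \<bar>empirical_cdf \<xi> n \<omega> t - F t\<bar>) \<ge> \<epsilon>}
    \<le> 2 * real (m - 1) * exp (- 2 * real n * \<delta>\<^sup>2)"
proof -
  have rv: "\<xi> k \<in> borel_measurable M" if "k \<ge> 1" for k
    using indep that unfolding indep_vars_def by auto
  have rv1[measurable]: "\<xi> 1 \<in> borel_measurable M" by (rule rv) simp
  have Fmono: "mono F"
  proof (rule monoI)
    fix x y :: real assume "x \<le> y"
    moreover have "{\<omega> \<in> space M. \<xi> 1 \<omega> \<le> y} \<in> events" by measurable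
    ultimately show "F x \<le> F y"
      unfolding F by (intro finite_measure_mono) auto
  qed
  have F01: "F t \<in> {0..1}" for t
    by (simp add: F)
  obtain \<omega>0 where "\<omega>0 \<in> space M" using not_empty by auto
  hence ab: "a \<le> b" using range[of \<omega>0] by simp
  \<comment> \<open>Starting to the left of \<open>a\<close> makes \<open>F\<close> vanish at the left end by definition.\<close>
  have "{\<omega> \<in> space M. \<xi> 1 \<omega> \<le> a - 1} = {}" using range by force
  hence Fa: "F (a - 1) = 0" by (simp only: F measure_empty)
  have "{\<omega> \<in> space M. \<xi> 1 \<omega> \<le> b} = space M" using range by force
  hence Fb: "F b = 1" by (simp only: F prob_space)
  have "\<exists>x. F x = real j / real m" if "j \<in> {1..<m}" for j
  proof -
    have "\<exists>x. a - 1 \<le> x \<and> x \<le> b \<and> F x = real j / real m"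
      by (rule IVT')
        (use that ab continuous_on_subset[OF cont] in \<open>auto simp: Fa Fb divide_le_eq\<close>)
    thus ?thesis by blast
  qed
  then obtain s where s: "\<And>j. j \<in> {1..<m} \<Longrightarrow> F (s j) = real j / real m"
    by metis
  define B where "B = (\<lambda>j. {\<omega> \<in> space M. \<bar>empirical_cdf \<xi> n \<omega> (s j) - F (s j)\<bar> \<ge> \<delta>})"
  have B: "B j \<in> events" for j
  proof -
    have [measurable]: "(\<lambda>\<omega>. empirical_cdf \<xi> n \<omega> (s j)) \<in> borel_measurable M"
      unfolding empirical_cdf_def
      by (intro borel_measurable_times borel_measurable_const borel_measurable_sum
          measurable_compose[OF rv]) auto
    show ?thesis unfolding B_def by measurable
  qed
  have "{\<omega> \<in> space M. (SUP t\<in>T. \<bar>empirical_cdf \<xi> n \<omega> t - F t\<bar>) \<ge> \<epsilon>} \<subseteq> (\<Union>j\<in>{1..<m}. B j)"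
  proof (safe, rule ccontr)
    fix \<omega> assume \<omega>: "\<omega> \<in> space M" "\<omega> \<notin> (\<Union>j\<in>{1..<m}. B j)"
      and sup: "\<epsilon> \<le> (SUP t\<in>T. \<bar>empirical_cdf \<xi> n \<omega> t - F t\<bar>)"
    have dev: "\<bar>empirical_cdf \<xi> n \<omega> (s j) - F (s j)\<bar> \<le> \<delta>" if "j \<in> {1..<m}" for j
      using \<omega> that by (force simp: B_def)
    have "(SUP t\<in>T. \<bar>empirical_cdf \<xi> n \<omega> t - F t\<bar>) \<le> \<delta> + 1 / real m"
      by (intro cSUP_least T mono_deviation_le_of_quantiles[where s = s]
          Fmono F01 mono_empirical_cdf empirical_cdf_in_unit m \<delta>(1) s dev)
    with sup \<delta>(2) show False by simp
  qed
  hence "prob {\<omega> \<in> space M. (SUP t\<in>T. \<bar>empirical_cdf \<xi> n \<omega> t - F t\<bar>) \<ge> \<epsilon>}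
      \<le> prob (\<Union>j\<in>{1..<m}. B j)"
    using B by (intro finite_measure_mono) auto
  also have "\<dots> \<le> (\<Sum>j\<in>{1..<m}. prob (B j))"
    using B by (intro finite_measure_subadditive_finite) auto
  also have "\<dots> \<le> (\<Sum>j\<in>{1..<m}. 2 * exp (- 2 * real n * \<delta>\<^sup>2))"
    unfolding B_def F by (intro sum_mono Hoeffding_empirical_cdf indep ident n \<delta>(1))
  finally show ?thesis by simp
qed

end

section \<open>Comparison of the exponents\<close>

lemma exponent_le_cube:
  fixes \<epsilon> :: real
  assumes "\<epsilon> > 0"
  shows "\<epsilon> / 8 * (ln (1 + \<epsilon>\<^sup>2 / 32) - 1) + 4 / \<epsilon> * ln (1 + \<epsilon>\<^sup>2 / 32) \<le> \<epsilon> ^ 3 / 256"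
proof -
  have "ln (1 + \<epsilon>\<^sup>2 / 32) \<le> \<epsilon>\<^sup>2 / 32" by (rule ln_add_one_self_le_self) simp
  hence "\<epsilon> / 8 * (ln (1 + \<epsilon>\<^sup>2 / 32) - 1) + 4 / \<epsilon> * ln (1 + \<epsilon>\<^sup>2 / 32)
      \<le> \<epsilon> / 8 * (\<epsilon>\<^sup>2 / 32 - 1) + 4 / \<epsilon> * (\<epsilon>\<^sup>2 / 32)"
    using assms by (intro add_mono mult_left_mono) auto
  also have "\<dots> = \<epsilon> ^ 3 / 256"
    using assms by (simp add: field_simps power2_eq_square power3_eq_cube)
  finally show ?thesis .
qed

text \<open>
  Here \<open>exp x \<ge> x\<close> suffices, because \<open>N \<epsilon>\<^sup>3 \<ge> 128\<close> makes the difference of the exponents a large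
  multiple of \<open>1 / \<epsilon>\<close>.
\<close>

lemma exp_absorbs_quantile_count:
  fixes \<epsilon> N :: real
  assumes "0 < \<epsilon>" "\<epsilon> \<le> 1" "N * \<epsilon> ^ 3 \<ge> 128"
  shows "2 / \<epsilon> * exp (- 2 * N * (\<epsilon> / 2)\<^sup>2) \<le> exp (- N * (\<epsilon> ^ 3 / 256))"
proof -
  have N: "N \<ge> 0"
    using assms by (smt (verit) mult_nonpos_nonneg zero_le_power)
  have "2 / \<epsilon> \<le> 32 / \<epsilon>" using assms by (simp add: divide_simps)
  also have "\<dots> \<le> N * \<epsilon>\<^sup>2 / 4"
    using assms by (simp add: field_simps power2_eq_square power3_eq_cube)
  also have "\<dots> \<le> N * \<epsilon>\<^sup>2 / 2 - N * \<epsilon> ^ 3 / 256"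
  proof -
    have "N * \<epsilon> ^ 3 \<le> N * \<epsilon>\<^sup>2"
      using assms N by (intro mult_left_mono power_decreasing) auto
    moreover have "0 \<le> N * \<epsilon>\<^sup>2" using N by simp
    ultimately show ?thesis by linarith
  qed
  also have "\<dots> \<le> exp \<dots>"
    using exp_ge_add_one_self[of "N * \<epsilon>\<^sup>2 / 2 - N * \<epsilon> ^ 3 / 256"] by linarith
  finally have "2 / \<epsilon> * exp (- 2 * N * (\<epsilon> / 2)\<^sup>2)
      \<le> exp (N * \<epsilon>\<^sup>2 / 2 - N * \<epsilon> ^ 3 / 256) * exp (- 2 * N * (\<epsilon> / 2)\<^sup>2)"
    by (intro mult_right_mono) auto
  also have "\<dots> = exp (- N * (\<epsilon> ^ 3 / 256))"
    by (simp add: power2_eq_square flip: exp_add)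
  finally show ?thesis .
qed

section \<open>The deviation inequality\<close>

theorem mainTheorem1:
  fixes M :: "'a measure" and \<xi> :: "nat \<Rightarrow> 'a \<Rightarrow> real" and F :: "real \<Rightarrow> real"
    and \<epsilon> :: real and n :: nat
  assumes "prob_space M"
    and indep: "prob_space.indep_vars M (\<lambda>_. borel) \<xi> {1..}"
    and ident: "\<And>k. k \<ge> 1 \<Longrightarrow> distr M borel (\<xi> k) = distr M borel (\<xi> 1)"
    and range: "\<And>k \<omega>. k \<ge> 1 \<Longrightarrow> \<omega> \<in> space M \<Longrightarrow> \<xi> k \<omega> \<in> {0..1}"
    and F: "\<And>t. F t = measure M {\<omega> \<in> space M. \<xi> 1 \<omega> \<le> t}"
    and cont: "continuous_on UNIV F"
    and "\<epsilon> > 0" and "n \<ge> 1"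
  shows "measure M {\<omega> \<in> space M. (SUP t\<in>{0..1}. \<bar>empirical_cdf \<xi> n \<omega> t - F t\<bar>) \<ge> \<epsilon>}
    \<le> 2 * exp (- real n * (\<epsilon> / 8 * (ln (1 + \<epsilon>\<^sup>2 / 32) - 1) + 4 / \<epsilon> * ln (1 + \<epsilon>\<^sup>2 / 32)))"
    (is "?P \<le> 2 * exp (- real n * ?\<phi>)")
proof -
  interpret prob_space M by fact
  have "{0..1::real} \<noteq> {}" by simp
  note dev = prob_sup_deviation_le[OF indep ident range[OF order.refl] F cont this \<open>n \<ge> 1\<close>]
  have cube: "exp (- real n * (\<epsilon> ^ 3 / 256)) \<le> exp (- real n * ?\<phi>)"
    using mult_left_mono[OF exponent_le_cube[OF \<open>\<epsilon> > 0\<close>], of "real n"] by simp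
  consider "\<epsilon> > 1" | "real n * \<epsilon> ^ 3 < 128" | "\<epsilon> \<le> 1" "real n * \<epsilon> ^ 3 \<ge> 128"
    by linarith
  thus ?thesis
  proof cases
    case 1
    have "?P \<le> 0" using dev[of 1 0 \<epsilon>] 1 by simp
    also have "\<dots> \<le> 2 * exp (- real n * ?\<phi>)" by simp
    finally show ?thesis .
  next
    case 2
    have "1 / 2 \<le> exp (- 1 / 2 :: real)"
      using exp_ge_add_one_self[of "- 1 / 2 :: real"] by simp
    also have "\<dots> \<le> exp (- real n * (\<epsilon> ^ 3 / 256))" using 2 by simp
    finally have "1 \<le> 2 * exp (- real n * ?\<phi>)" using cube by linarith
    with prob_le_1 show ?thesis by (rule order.trans)
  next
    case 3
    define m where "m = nat \<lfloor>2 / \<epsilon>\<rfloor> + 1"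
    have "2 / \<epsilon> > 0" using \<open>\<epsilon> > 0\<close> by simp
    hence m: "m \<ge> 1" "real (m - 1) \<le> 2 / \<epsilon>" "2 / \<epsilon> < real m"
      unfolding m_def by (auto, linarith)
    have "1 / real m < \<epsilon> / 2" using m(1,3) \<open>\<epsilon> > 0\<close> by (simp add: field_simps)
    hence "?P \<le> 2 * real (m - 1) * exp (- 2 * real n * (\<epsilon> / 2)\<^sup>2)"
      using \<open>\<epsilon> > 0\<close> by (intro dev m(1)) auto
    also have "\<dots> \<le> 2 * (2 / \<epsilon> * exp (- 2 * real n * (\<epsilon> / 2)\<^sup>2))"
      using mult_right_mono[OF m(2), of "exp (- 2 * real n * (\<epsilon> / 2)\<^sup>2)"] by simp
    also have "\<dots> \<le> 2 * exp (- real n * (\<epsilon> ^ 3 / 256))"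
      using exp_absorbs_quantile_count[OF \<open>\<epsilon> > 0\<close> 3] by simp
    also have "\<dots> \<le> 2 * exp (- real n * ?\<phi>)" using cube by simp
    finally show ?thesis .
  qed
qed

end
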